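(* Let $K\geq 2$ and $J\geq 1$ be integers. Let $\mathcal{Q}_J$ be the family of $J$-class latent class models on $(0,1]^K$ given by $$\mathcal{Q}_J=\Big\{Q=\sum_{j=1}^J\nu_{Q,j}\prod_{k=1}^K\delta_{\lambda_{Q,jk}} \;\Big|\; \nu_{Q,j}\geq 0,\ \sum_{j=1}^J\nu_{Q,j}=1,\ (\lambda_{Q,j1},\ldots,\lambda_{Q,jK})\in(0,1]^K \text{ for all } j,\ \lambda_{Q,jk}\neq\lambda_{Q,j'k}\text{ for all } j\neq j' \text{ and all } k\Big\}.$$ Then $\mathcal{Q}_J$ is identifiable if and only if $2J\leq K$.
   Context: Let $K\ge 2$, $H=\{0,1\}^K$, and $H^*=H\setminus\{(0,\ldots,0)\}$. For a probability distribution $Q$ on $(0,1]^K$, let $E_Q$ denote expectation when $(\lambda_1,\ldots,\lambda_K)\sim Q$. For $\boldsymbol{h}=(h_1,\ldots,h_K)\in H$ put $$\pi_{Q,\boldsymbol{h}}=E_Q\Big\{\prod_{k=1}^K \lambda_k^{h_k}(1-\lambda_k)^{1-h_k}\Big\},\qquad \pi_{Q,0}=\pi_{Q,(0,\ldots,0)},$$ and let $\tilde{\boldsymbol{\pi}}_Q=(\tilde{\pi}_{Q,\boldsymbol{h}})_{\boldsymbol{h}\in H^*}$ with $\tilde{\pi}_{Q,\boldsymbol{h}}=\pi_{Q,\boldsymbol{h}}/(1-\pi_{Q,0})$. (Since $Q$ lives on $(0,1]^K$, $\pi_{Q,0}<1$.) Definition (identifiability): a family $\mathcal{Q}$ of probability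 distributions on $(0,1]^K$ is identifiable if, for all $Q,R\in\mathcal{Q}$, $\tilde{\boldsymbol{\pi}}_Q=\tilde{\boldsymbol{\pi}}_R$ implies $\pi_{Q,0}=\pi_{R,0}$. Notation: $\delta_x$ is the point mass at $x$, and $\prod_{k=1}^K\delta_{\lambda_{Q,jk}}$ is the product measure, i.e. the point mass at $(\lambda_{Q,j1},\ldots,\lambda_{Q,jK})\in(0,1]^K$. Thus for $Q\in\mathcal{Q}_J$, $\pi_{Q,\boldsymbol{h}}=\sum_{j=1}^J\nu_{Q,j}\prod_{k=1}^K\lambda_{Q,jk}^{h_k}(1-\lambda_{Q,jk})^{1-h_k}$. Weights $\nu_{Q,j}$ are allowed to be zero. *)

theory Defs
  imports "HOL-Probability.Probability"
begin

definition unit_interval :: "real measure" where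
  "unit_interval = restrict_space borel {0<..1}"

text \<open>The measurable space \<open>(0,1]\<^sup>K\<close>; coordinates are indexed by \<open>{1..K}\<close>.\<close>

definition cube :: "nat \<Rightarrow> (nat \<Rightarrow> real) measure" where
  "cube K = (\<Pi>\<^sub>M k\<in>{1..K}. unit_interval)"

definition distributions :: "nat \<Rightarrow> (nat \<Rightarrow> real) measure set" where
  "distributions K = {Q. prob_space Q \<and> sets Q = sets (cube K)}"

definition histories :: "nat \<Rightarrow> (nat \<Rightarrow> nat) set" where
  "histories K = {1..K} \<rightarrow>\<^sub>E {0, 1}"

definition null_history :: "nat \<Rightarrow> nat \<Rightarrow> nat" where
  "null_history K = (\<lambda>k\<in>{1..K}. 0)"

text \<open>\<open>cell_prob K Q h\<close> is \<open>\<pi>\<close> for \<open>Q\<close> and \<open>h\<close>; \<open>observed_probs K Q\<close> is the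
  vector of the \<open>\<pi> / (1 - \<pi>\<^sub>0)\<close>, indexed by the non-null histories only.\<close>

definition cell_prob :: "nat \<Rightarrow> (nat \<Rightarrow> real) measure \<Rightarrow> (nat \<Rightarrow> nat) \<Rightarrow> real" where
  "cell_prob K Q h = (\<integral>l. (\<Prod>k = 1..K. l k ^ h k * (1 - l k) ^ (1 - h k)) \<partial>Q)"

definition null_prob :: "nat \<Rightarrow> (nat \<Rightarrow> real) measure \<Rightarrow> real" where
  "null_prob K Q = cell_prob K Q (null_history K)"

definition observed_probs :: "nat \<Rightarrow> (nat \<Rightarrow> real) measure \<Rightarrow> (nat \<Rightarrow> nat) \<Rightarrow> real" where
  "observed_probs K Q =
     (\<lambda>h\<in>histories K - {null_history K}. cell_prob K Q h / (1 - null_prob K Q))"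

text \<open>Intended for families \<open>\<Q> \<subseteq> distributions K\<close>.\<close>

definition identifiable :: "nat \<Rightarrow> (nat \<Rightarrow> real) measure set \<Rightarrow> bool" where
  "identifiable K \<Q> \<longleftrightarrow>
     (\<forall>Q\<in>\<Q>. \<forall>R\<in>\<Q>. observed_probs K Q = observed_probs K R \<longrightarrow> null_prob K Q = null_prob K R)"

text \<open>The measure \<open>\<Sum>j\<in>I. \<nu> j * M j\<close> on the measurable space of \<open>N\<close>.\<close>

definition mixture ::
    "'a measure \<Rightarrow> 'i set \<Rightarrow> ('i \<Rightarrow> real) \<Rightarrow> ('i \<Rightarrow> 'a measure) \<Rightarrow> 'a measure" where
  "mixture N I \<nu> M =
     measure_of (space N) (sets N) (\<lambda>A. \<Sum>j\<in>I. ennreal (\<nu> j) * emeasure (M j) A)"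

definition latent_class_models :: "nat \<Rightarrow> nat \<Rightarrow> (nat \<Rightarrow> real) measure set" where
  "latent_class_models J K =
     {mixture (cube K) {1..J} \<nu> (\<lambda>j. \<Pi>\<^sub>M k\<in>{1..K}. return unit_interval (lam j k)) | \<nu> lam.
        (\<forall>j\<in>{1..J}. 0 \<le> \<nu> j) \<and> (\<Sum>j = 1..J. \<nu> j) = 1 \<and>
        (\<forall>j\<in>{1..J}. \<forall>k\<in>{1..K}. lam j k \<in> {0<..1}) \<and>
        (\<forall>j\<in>{1..J}. \<forall>j'\<in>{1..J}. j \<noteq> j' \<longrightarrow> (\<forall>k\<in>{1..K}. lam j k \<noteq> lam j' k))}"

lemma space_unit_interval [simp]: "space unit_interval = {0<..1}"
  by (simp add: unit_interval_def space_restrict_space)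

lemma space_mixture [simp]: "space (mixture N I \<nu> M) = space N"
  and sets_mixture [simp]: "sets (mixture N I \<nu> M) = sets N"
  by (simp_all add: mixture_def)

lemma emeasure_mixture:
  assumes "finite I" "\<And>j. j \<in> I \<Longrightarrow> sets (M j) = sets N" "A \<in> sets N"
  shows "emeasure (mixture N I \<nu> M) A = (\<Sum>j\<in>I. ennreal (\<nu> j) * emeasure (M j) A)"
  unfolding mixture_def
proof (rule emeasure_measure_of_sigma)
  show "sigma_algebra (space N) (sets N)" ..
  show "positive (sets N) (\<lambda>A. \<Sum>j\<in>I. ennreal (\<nu> j) * emeasure (M j) A)"
    by (simp add: positive_def)
  show "countably_additive (sets N) (\<lambda>A. \<Sum>j\<in>I. ennreal (\<nu> j) * emeasure (M j) A)"
  proof (rule countably_additiveI)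
    fix A :: "nat \<Rightarrow> _" assume A: "range A \<subseteq> sets N" "disjoint_family A"
    have "(\<Sum>i. \<Sum>j\<in>I. ennreal (\<nu> j) * emeasure (M j) (A i)) =
        (\<Sum>j\<in>I. \<Sum>i. ennreal (\<nu> j) * emeasure (M j) (A i))"
      by (intro suminf_sum) auto
    also have "\<dots> = (\<Sum>j\<in>I. ennreal (\<nu> j) * emeasure (M j) (\<Union>i. A i))"
      using A assms(2) by (intro sum.cong) (simp_all add: suminf_emeasure)
    finally show "(\<Sum>i. \<Sum>j\<in>I. ennreal (\<nu> j) * emeasure (M j) (A i)) =
        (\<Sum>j\<in>I. ennreal (\<nu> j) * emeasure (M j) (\<Union>i. A i))" .
  qed
qed fact

lemma point_mass_cube:
  assumes "\<And>k. k \<in> {1..K} \<Longrightarrow> x k \<in> {0<..1}"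
  shows "(\<Pi>\<^sub>M k\<in>{1..K}. return unit_interval (x k)) = return (cube K) (restrict x {1..K})"
  unfolding cube_def
proof (rule PiM_return)
  fix k assume "k \<in> {1..K}"
  then show "{x k} \<in> sets unit_interval"
    using assms[of k] by (auto simp: unit_interval_def sets_restrict_space intro!: image_eqI[of _ _ "{x k}"])
qed simp

lemma latent_class_models_subset: "latent_class_models J K \<subseteq> distributions K"
proof
  fix Q assume "Q \<in> latent_class_models J K"
  then obtain \<nu> lam where
    Q: "Q = mixture (cube K) {1..J} \<nu> (\<lambda>j. \<Pi>\<^sub>M k\<in>{1..K}. return unit_interval (lam j k))"
    and \<nu>: "\<And>j. j \<in> {1..J} \<Longrightarrow> 0 \<le> \<nu> j" "(\<Sum>j = 1..J. \<nu> j) = 1"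
    and lam: "\<And>j k. j \<in> {1..J} \<Longrightarrow> k \<in> {1..K} \<Longrightarrow> lam j k \<in> {0<..1}"
    unfolding latent_class_models_def by blast
  let ?M = "\<lambda>j. \<Pi>\<^sub>M k\<in>{1..K}. return unit_interval (lam j k)"
  have sets_M: "sets (?M j) = sets (cube K)" for j
    unfolding cube_def by (intro sets_PiM_cong) simp_all
  have M: "emeasure (?M j) (space (cube K)) = 1" if "j \<in> {1..J}" for j
  proof -
    interpret prob_space "?M j"
      using lam that by (intro prob_space_PiM prob_space_return) simp
    show ?thesis using emeasure_space_1 sets_eq_imp_space_eq[OF sets_M] by metis
  qed
  have "emeasure Q (space Q) = (\<Sum>j\<in>{1..J}. ennreal (\<nu> j) * emeasure (?M j) (space (cube K)))"
    unfolding Q space_mixture by (rule emeasure_mixture) (rule finite_atLeastAtMost sets_M sets.top)+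
  also have "\<dots> = (\<Sum>j\<in>{1..J}. ennreal (\<nu> j))"
    using M by (intro sum.cong) auto
  also have "\<dots> = 1"
    using \<nu> by (subst sum_ennreal) auto
  finally have "prob_space Q" by (rule prob_spaceI)
  then show "Q \<in> distributions K" by (simp add: distributions_def Q)
qed

end

theory Submission
  imports Defs
begin

text \<open>
  A latent class model has finitely many atoms, so its cell probabilities are finite weighted sums
  of the multi-affine weights \<open>\<Prod>k. x k ^ h k * (1 - x k) ^ (1 - h k)\<close>
  (\<open>cell_prob_latent_class_model\<close>).  Equality of the observed probabilities of \<open>Q\<close> and \<open>R\<close> says
  that \<open>\<pi>\<^bsub>Q,h\<^esub>\<close> and \<open>\<pi>\<^bsub>R,h\<^esub>\<close> are proportional on the non-null histories \<open>h\<close>.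

  If \<open>2 * J \<le> K\<close>, there are enough coordinates to give each atom of \<open>Q\<close> and each atom of \<open>R\<close> a
  coordinate of its own.  The product \<open>f x = (\<Prod>k. 1 - c k * x k)\<close>, where \<open>c k\<close> is the inverse of
  the \<open>k\<close>-th coordinate of the atom that owns \<open>k\<close>, vanishes at all these atoms and equals \<open>1\<close> at
  the origin.  A multi-affine function is the interpolation of its values on the vertices of the
  cube, so \<open>E\<^sub>Q f = (\<Sum>h. f h * \<pi>\<^bsub>Q,h\<^esub>)\<close>, and this is \<open>0\<close>.  Isolating the null history yields
  \<open>\<pi>\<^sub>0 / (1 - \<pi>\<^sub>0) = - (\<Sum>h \<noteq> 0. f h * \<pi>\<^sub>h / (1 - \<pi>\<^sub>0))\<close> for both models with the same \<open>f\<close>, so the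
  observed probabilities determine the odds of \<open>\<pi>\<^sub>0\<close> (\<open>null_odds_eq_observed_sum\<close>).

  If \<open>K < 2 * J\<close>, put \<open>n = 2 * J\<close> and take atoms on the diagonal at \<open>i / n\<close>, the even \<open>i \<ge> 2\<close>
  for \<open>Q\<close> and the odd \<open>i\<close> for \<open>R\<close>, with weights proportional to \<open>n choose i\<close>.  On the diagonal
  a cell probability weight is a polynomial of degree at most \<open>K < n\<close>, so its alternating binomial
  sum over \<open>{0..n}\<close>, an \<open>n\<close>-th finite difference, vanishes.  Only the null history sees the term
  \<open>i = 0\<close>, because that term is the weight at the origin.  Hence the unnormalised models agree
  on every non-null history, so their observed probabilities coincide, while their total masses
  differ by \<open>1\<close>; dividing by different total masses makes the null probabilities different.
\<close>

section \<open>Cell probabilities of latent class models\<close>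

definition history_prob :: "nat \<Rightarrow> (nat \<Rightarrow> real) \<Rightarrow> (nat \<Rightarrow> nat) \<Rightarrow> real" where
  "history_prob K x h = (\<Prod>k = 1..K. x k ^ h k * (1 - x k) ^ (1 - h k))"

definition latent_class_model ::
    "nat \<Rightarrow> nat \<Rightarrow> (nat \<Rightarrow> real) \<Rightarrow> (nat \<Rightarrow> nat \<Rightarrow> real) \<Rightarrow> (nat \<Rightarrow> real) measure" where
  "latent_class_model J K \<nu> lam =
     mixture (cube K) {1..J} \<nu> (\<lambda>j. \<Pi>\<^sub>M k\<in>{1..K}. return unit_interval (lam j k))"

text \<open>
  As the image of a point measure on the index set, a mixture of point masses gets its integrals
  from the transformation formula.
\<close>

lemma mixture_return_eq_distr:
  assumes I: "finite I" and x: "\<And>j. j \<in> I \<Longrightarrow> x j \<in> space N"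
    and M: "\<And>j. j \<in> I \<Longrightarrow> M j = return N (x j)"
    and \<nu>: "\<And>j. j \<in> I \<Longrightarrow> (0::real) \<le> \<nu> j"
  shows "mixture N I \<nu> M = distr (point_measure I (\<lambda>j. ennreal (\<nu> j))) N x"
proof (rule measure_eqI)
  have meas: "x \<in> measurable (point_measure I (\<lambda>j. ennreal (\<nu> j))) N"
    using x by (simp add: measurable_def space_point_measure sets_point_measure Pi_def)
  fix A assume "A \<in> sets (mixture N I \<nu> M)"
  then have A: "A \<in> sets N" by simp
  have "emeasure (mixture N I \<nu> M) A = (\<Sum>j\<in>I. ennreal (\<nu> j) * indicator A (x j))"
    using A M by (subst emeasure_mixture[OF I]) (auto intro!: sum.cong)
  also have "\<dots> = (\<Sum>j\<in>x -` A \<inter> I. ennreal (\<nu> j))"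
    using I by (intro sum.mono_neutral_cong_right) (auto simp: indicator_def)
  also have "\<dots> = emeasure (distr (point_measure I (\<lambda>j. ennreal (\<nu> j))) N x) A"
    using I by (simp add: emeasure_distr[OF meas A] space_point_measure emeasure_point_measure_finite)
  finally show "emeasure (mixture N I \<nu> M) A =
      emeasure (distr (point_measure I (\<lambda>j. ennreal (\<nu> j))) N x) A" .
qed simp

lemma integral_mixture_return:
  fixes f :: "'a \<Rightarrow> real"
  assumes I: "finite I" and x: "\<And>j. j \<in> I \<Longrightarrow> x j \<in> space N"
    and M: "\<And>j. j \<in> I \<Longrightarrow> M j = return N (x j)"
    and \<nu>: "\<And>j. j \<in> I \<Longrightarrow> (0::real) \<le> \<nu> j"
    and f: "f \<in> borel_measurable N"
  shows "integral\<^sup>L (mixture N I \<nu> M) f = (\<Sum>j\<in>I. \<nu> j * f (x j))"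
proof -
  have meas: "x \<in> measurable (point_measure I (\<lambda>j. ennreal (\<nu> j))) N"
    using x by (simp add: measurable_def space_point_measure sets_point_measure Pi_def)
  have "integral\<^sup>L (mixture N I \<nu> M) f =
      integral\<^sup>L (distr (point_measure I (\<lambda>j. ennreal (\<nu> j))) N x) f"
    using mixture_return_eq_distr[of I x N M \<nu>] I x M \<nu> by simp
  also have "\<dots> = (\<integral>j. f (x j) \<partial>point_measure I (\<lambda>j. ennreal (\<nu> j)))"
    by (rule integral_distr[OF meas f])
  also have "\<dots> = (\<Sum>j\<in>I. \<nu> j * f (x j))"
    using I \<nu> by (simp add: lebesgue_integral_point_measure_finite)
  finally show ?thesis .
qed

lemma measurable_history_prob: "(\<lambda>x. history_prob K x h) \<in> borel_measurable (cube K)"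
proof -
  have "(\<lambda>x. x k) \<in> borel_measurable (cube K)" if "k \<in> {1..K}" for k
  proof -
    have "(\<lambda>x. x k) \<in> measurable (cube K) unit_interval"
      unfolding cube_def using that by (rule measurable_component_singleton)
    moreover have "(\<lambda>y. y) \<in> measurable unit_interval borel"
      unfolding unit_interval_def by (intro measurable_restrict_space1) simp
    ultimately show ?thesis by (rule measurable_compose)
  qed
  then show ?thesis
    unfolding history_prob_def
    by (intro borel_measurable_prod borel_measurable_times borel_measurable_power
        borel_measurable_diff borel_measurable_const)
qed

lemma cell_prob_latent_class_model:
  assumes \<nu>: "\<And>j. j \<in> {1..J} \<Longrightarrow> 0 \<le> \<nu> j"
    and lam: "\<And>j k. j \<in> {1..J} \<Longrightarrow> k \<in> {1..K} \<Longrightarrow> lam j k \<in> {0<..1}"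
  shows "cell_prob K (latent_class_model J K \<nu> lam) h = (\<Sum>j = 1..J. \<nu> j * history_prob K (lam j) h)"
proof -
  have "cell_prob K (latent_class_model J K \<nu> lam) h =
      (\<integral>x. history_prob K x h \<partial>latent_class_model J K \<nu> lam)"
    by (simp add: cell_prob_def history_prob_def)
  also have "\<dots> = (\<Sum>j = 1..J. \<nu> j * history_prob K (restrict (lam j) {1..K}) h)"
    unfolding latent_class_model_def
  proof (rule integral_mixture_return)
    fix j assume j: "j \<in> {1..J}"
    show "restrict (lam j) {1..K} \<in> space (cube K)"
      using lam j by (auto simp: cube_def space_PiM)
    show "(\<Pi>\<^sub>M k\<in>{1..K}. return unit_interval (lam j k)) = return (cube K) (restrict (lam j) {1..K})"
      using lam j by (intro point_mass_cube)
  qed (use \<nu> measurable_history_prob in auto)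
  also have "\<dots> = (\<Sum>j = 1..J. \<nu> j * history_prob K (lam j) h)"
    by (simp add: history_prob_def)
  finally show ?thesis .
qed

lemma null_prob_latent_class_model_less_1:
  assumes "K \<ge> 1"
    and \<nu>: "\<And>j. j \<in> {1..J} \<Longrightarrow> 0 \<le> \<nu> j" "(\<Sum>j = 1..J. \<nu> j) = 1"
    and lam: "\<And>j k. j \<in> {1..J} \<Longrightarrow> k \<in> {1..K} \<Longrightarrow> lam j k \<in> {0<..1}"
  shows "null_prob K (latent_class_model J K \<nu> lam) < 1"
proof -
  let ?p = "\<lambda>j. history_prob K (lam j) (null_history K)"
  have p: "?p j < 1" if "j \<in> {1..J}" for j
  proof -
    have "?p j = (\<Prod>k = 1..K. 1 - lam j k)"
      by (simp add: history_prob_def null_history_def)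
    also have "\<dots> < (\<Prod>k = 1..K. 1)"
      using lam[OF that] \<open>K \<ge> 1\<close> by (intro prod_mono_strict[of 1]) (auto simp: less_imp_le)
    finally show ?thesis by simp
  qed
  obtain i where i: "i \<in> {1..J}" "\<nu> i \<noteq> 0"
    using \<nu>(2) by (metis (no_types, lifting) sum.neutral zero_neq_one)
  have "(\<Sum>j = 1..J. \<nu> j * ?p j) < (\<Sum>j = 1..J. \<nu> j)"
  proof (rule sum_strict_mono_ex1)
    show "\<forall>j\<in>{1..J}. \<nu> j * ?p j \<le> \<nu> j"
      by (intro ballI mult_left_le less_imp_le p \<nu>(1))
    have "\<nu> i > 0" using \<nu>(1)[OF i(1)] i(2) by simp
    then show "\<exists>j\<in>{1..J}. \<nu> j * ?p j < \<nu> j"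
      using p[OF i(1)] i(1) by (intro bexI[of _ i]) simp_all
  qed simp
  then show ?thesis
    using cell_prob_latent_class_model[of J \<nu> K lam "null_history K"] \<nu> lam
    by (simp only: null_prob_def)
qed

section \<open>Identifiability when there are two coordinates per class\<close>

lemma finite_histories: "finite (histories K)"
  by (simp add: histories_def finite_PiE)

lemma null_history_in_histories: "null_history K \<in> histories K"
  by (simp add: null_history_def histories_def)

text \<open>
  In each coordinate, an affine function is the interpolation of its values at \<open>0\<close> and \<open>1\<close> with
  weights \<open>1 - x k\<close> and \<open>x k\<close>; multiplying out over the coordinates gives the sum over histories.
\<close>

lemma sum_histories_interpolates:
  "(\<Sum>h\<in>histories K. (\<Prod>k = 1..K. 1 - c k * real (h k)) * history_prob K x h) =
   (\<Prod>k = 1..K. 1 - c k * x k)"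
proof -
  have "(\<Prod>k = 1..K. 1 - c k * x k) =
      (\<Prod>k = 1..K. \<Sum>e\<in>{0, 1::nat}. (1 - c k * real e) * (x k ^ e * (1 - x k) ^ (1 - e)))"
    by (intro prod.cong) (auto simp: algebra_simps)
  also have "\<dots> = (\<Sum>h\<in>histories K.
      \<Prod>k = 1..K. (1 - c k * real (h k)) * (x k ^ h k * (1 - x k) ^ (1 - h k)))"
    unfolding histories_def by (intro prod_sum_PiE) auto
  finally show ?thesis
    by (simp add: history_prob_def prod.distrib)
qed

text \<open>
  The function \<open>\<lambda>x. \<Prod>k. 1 - c k * x k\<close> is assumed to vanish at every atom, so its expectation is
  \<open>0\<close>.  Since it equals \<open>1\<close> at the origin, this expresses the null probability through the other
  cells, with coefficients that depend on \<open>c\<close> only.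
\<close>

lemma null_odds_eq_observed_sum:
  assumes \<nu>: "\<And>j. j \<in> {1..J} \<Longrightarrow> 0 \<le> \<nu> j"
    and lam: "\<And>j k. j \<in> {1..J} \<Longrightarrow> k \<in> {1..K} \<Longrightarrow> lam j k \<in> {0<..1}"
    and c: "\<And>j. j \<in> {1..J} \<Longrightarrow> \<exists>k\<in>{1..K}. c k * lam j k = 1"
  defines "Q \<equiv> latent_class_model J K \<nu> lam"
  shows "null_prob K Q / (1 - null_prob K Q) =
    - (\<Sum>h\<in>histories K - {null_history K}. (\<Prod>k = 1..K. 1 - c k * real (h k)) * observed_probs K Q h)"
proof -
  let ?f = "\<lambda>h. \<Prod>k = 1..K. 1 - c k * real (h k)"
  let ?S = "\<Sum>h\<in>histories K - {null_history K}. ?f h * cell_prob K Q h"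
  have cell: "cell_prob K Q h = (\<Sum>j = 1..J. \<nu> j * history_prob K (lam j) h)" for h
    unfolding Q_def using \<nu> lam by (intro cell_prob_latent_class_model)
  have "(\<Sum>h\<in>histories K. ?f h * cell_prob K Q h) =
      (\<Sum>h\<in>histories K. \<Sum>j = 1..J. \<nu> j * (?f h * history_prob K (lam j) h))"
    by (simp add: cell sum_distrib_left sum_distrib_right mult_ac)
  also have "\<dots> = (\<Sum>j = 1..J. \<nu> j * (\<Sum>h\<in>histories K. ?f h * history_prob K (lam j) h))"
    by (subst sum.swap) (simp add: sum_distrib_left)
  also have "\<dots> = (\<Sum>j = 1..J. \<nu> j * (\<Prod>k = 1..K. 1 - c k * lam j k))"
    by (simp only: sum_histories_interpolates)
  also have "\<dots> = 0"
    using c by (intro sum.neutral ballI) (force simp: prod_zero_iff)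
  finally have "?f (null_history K) * cell_prob K Q (null_history K) + ?S = 0"
    using sum.remove[OF finite_histories null_history_in_histories] by metis
  then have "null_prob K Q = - ?S"
    by (simp add: null_prob_def null_history_def)
  then have "null_prob K Q / (1 - null_prob K Q) = - (?S / (1 - null_prob K Q))"
    by simp
  also have "?S / (1 - null_prob K Q) =
      (\<Sum>h\<in>histories K - {null_history K}. ?f h * observed_probs K Q h)"
    by (simp add: observed_probs_def sum_divide_distrib)
  finally show ?thesis .
qed

lemma latent_class_modelsE:
  assumes "Q \<in> latent_class_models J K"
  obtains \<nu> lam where "Q = latent_class_model J K \<nu> lam"
    "\<And>j. j \<in> {1..J} \<Longrightarrow> 0 \<le> \<nu> j" "(\<Sum>j = 1..J. \<nu> j) = 1"
    "\<And>j k. j \<in> {1..J} \<Longrightarrow> k \<in> {1..K} \<Longrightarrow> lam j k \<in> {0<..1}"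
  using assms unfolding latent_class_models_def latent_class_model_def by blast

lemma identifiable_latent_class_models:
  assumes "K \<ge> 1" "2 * J \<le> K"
  shows "identifiable K (latent_class_models J K)"
  unfolding identifiable_def
proof (intro ballI impI)
  fix Q R
  assume "Q \<in> latent_class_models J K" "R \<in> latent_class_models J K"
    and obs: "observed_probs K Q = observed_probs K R"
  then obtain \<nu> lam \<mu> eta where
    Q: "Q = latent_class_model J K \<nu> lam" and \<nu>: "\<And>j. j \<in> {1..J} \<Longrightarrow> 0 \<le> \<nu> j" "(\<Sum>j = 1..J. \<nu> j) = 1"
    and lam: "\<And>j k. j \<in> {1..J} \<Longrightarrow> k \<in> {1..K} \<Longrightarrow> lam j k \<in> {0<..1}" and
    R: "R = latent_class_model J K \<mu> eta" and \<mu>: "\<And>j. j \<in> {1..J} \<Longrightarrow> 0 \<le> \<mu> j" "(\<Sum>j = 1..J. \<mu> j) = 1"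
    and eta: "\<And>j k. j \<in> {1..J} \<Longrightarrow> k \<in> {1..K} \<Longrightarrow> eta j k \<in> {0<..1}"
    by (elim latent_class_modelsE) blast
  \<comment> \<open>Coordinate \<open>j\<close> is owned by the \<open>j\<close>-th atom of \<open>Q\<close>, coordinate \<open>J + j\<close> by the \<open>j\<close>-th atom
    of \<open>R\<close>; beyond \<open>2 * J\<close> any value of \<open>c\<close> will do.\<close>
  define c where "c k = (if k \<le> J then 1 / lam k k else 1 / eta (k - J) k)" for k
  have "\<exists>k\<in>{1..K}. c k * lam j k = 1" if "j \<in> {1..J}" for j
    using that lam[of j j] assms by (intro bexI[of _ j]) (auto simp: c_def)
  from null_odds_eq_observed_sum[OF \<nu>(1) lam this]
  have odds_Q: "null_prob K Q / (1 - null_prob K Q) =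
      - (\<Sum>h\<in>histories K - {null_history K}. (\<Prod>k = 1..K. 1 - c k * real (h k)) * observed_probs K Q h)"
    by (simp add: Q)
  have "\<exists>k\<in>{1..K}. c k * eta j k = 1" if "j \<in> {1..J}" for j
    using that eta[of j "J + j"] assms by (intro bexI[of _ "J + j"]) (auto simp: c_def)
  from null_odds_eq_observed_sum[OF \<mu>(1) eta this]
  have odds_R: "null_prob K R / (1 - null_prob K R) =
      - (\<Sum>h\<in>histories K - {null_history K}. (\<Prod>k = 1..K. 1 - c k * real (h k)) * observed_probs K R h)"
    by (simp add: R)
  have "null_prob K Q < 1"
    unfolding Q using assms \<nu> lam by (intro null_prob_latent_class_model_less_1)
  moreover have "null_prob K R < 1"
    unfolding R using assms \<mu> eta by (intro null_prob_latent_class_model_less_1)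
  moreover have "null_prob K Q / (1 - null_prob K Q) = null_prob K R / (1 - null_prob K R)"
    using odds_Q odds_R obs by simp
  ultimately show "null_prob K Q = null_prob K R"
    by (simp add: frac_eq_eq algebra_simps)
qed

section \<open>Two interlacing models with proportional observed cells\<close>

text \<open>
  An alternating binomial sum is an \<open>n\<close>-th finite difference, and each difference
  \<open>p x - p (x + 1)\<close> lowers the degree because the leading coefficients cancel.
\<close>

lemma alternating_binomial_sum_poly_eq_0:
  fixes p :: "real poly"
  assumes "degree p < n"
  shows "(\<Sum>i\<le>n. (-1) ^ i * real (n choose i) * poly p (real i)) = 0"
  using assms
proof (induction n arbitrary: p)
  case 0
  then show ?case by simp
next
  case (Suc n)
  define q where "q = p - p \<circ>\<^sub>p [:1, 1:]"
  let ?a = "\<lambda>n i. (-1) ^ i * real (n choose i)"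
  have "(\<Sum>i\<le>Suc n. ?a (Suc n) i * poly p (real i)) =
      poly p 0 + (\<Sum>i\<le>n. ?a (Suc n) (Suc i) * poly p (real (Suc i)))"
    by (subst sum.atMost_Suc_shift) simp
  also have "\<dots> = poly p 0 + (\<Sum>i\<le>n. ?a n (Suc i) * poly p (real (Suc i)))
      - (\<Sum>i\<le>n. ?a n i * poly p (real (Suc i)))"
  proof -
    have "?a (Suc n) (Suc i) * y = ?a n (Suc i) * y - ?a n i * y" for i y
      by (simp add: algebra_simps)
    then show ?thesis by (simp only: sum_subtractf add_diff_eq)
  qed
  also have "poly p 0 + (\<Sum>i\<le>n. ?a n (Suc i) * poly p (real (Suc i))) =
      (\<Sum>i\<le>Suc n. ?a n i * poly p (real i))"
    by (subst sum.atMost_Suc_shift) simp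
  also have "\<dots> = (\<Sum>i\<le>n. ?a n i * poly p (real i))"
    by simp
  also have "\<dots> - (\<Sum>i\<le>n. ?a n i * poly p (real (Suc i))) = (\<Sum>i\<le>n. ?a n i * poly q (real i))"
    by (simp add: q_def poly_pcompose sum_subtractf [symmetric] algebra_simps)
  also have "\<dots> = 0"
  proof (cases "degree p = 0")
    case True
    then have "q = 0"
      by (elim degree_eq_zeroE) (simp add: q_def)
    then show ?thesis by simp
  next
    case False
    have "degree q < degree p"
    proof (rule degree_lessI)
      have deg: "degree (p \<circ>\<^sub>p [:1, 1:]) = degree p"
        by (simp add: degree_pcompose)
      have "lead_coeff (p \<circ>\<^sub>p [:1, 1:]) = lead_coeff p"
        by (subst lead_coeff_comp) simp_all
      then have "coeff q (degree p) = 0"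
        by (simp add: q_def deg)
      moreover have "coeff q k = 0" if "k > degree p" for k
        using that deg by (simp add: q_def coeff_eq_0)
      ultimately show "\<forall>k\<ge>degree p. coeff q k = 0"
        by (metis le_neq_implies_less)
    qed (use False in simp)
    with Suc.prems show ?thesis by (intro Suc.IH) simp
  qed
  finally show ?case .
qed

lemma sum_even_odd_split:
  fixes f :: "nat \<Rightarrow> real"
  shows "(\<Sum>i\<le>2 * J. (-1) ^ i * f i) = f 0 + (\<Sum>j = 1..J. f (2 * j)) - (\<Sum>j = 1..J. f (2 * j - 1))"
  by (induction J) simp_all

lemma history_prob_diagonal_poly:
  assumes "h \<in> histories K"
  obtains p where "degree p \<le> K" "\<And>y. poly p y = history_prob K (\<lambda>_. y / real n) h"
proof
  define g where "g k = [:0, 1 / real n:] ^ h k * [:1, - (1 / real n):] ^ (1 - h k)" for k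
  show "degree (\<Prod>k = 1..K. g k) \<le> K"
  proof -
    have "degree (g k) \<le> 1" if "k \<in> {1..K}" for k
    proof -
      have "h k \<in> {0, 1}" using assms that unfolding histories_def by (rule PiE_mem)
      then show ?thesis by (auto simp: g_def)
    qed
    then have "sum (degree \<circ> g) {1..K} \<le> (\<Sum>k\<in>{1..K}. 1)"
      by (intro sum_mono) simp
    with degree_prod_sum_le[of "{1..K}" g] show ?thesis by simp
  qed
  show "poly (\<Prod>k = 1..K. g k) y = history_prob K (\<lambda>_. y / real n) h" for y
    by (simp add: poly_prod g_def history_prob_def)
qed

text \<open>
  A non-null history has probability \<open>0\<close> at the origin, so there the term \<open>i = 0\<close> of the alternating
  sum is absent; the null history has probability \<open>1\<close> there.
\<close>

lemma history_prob_origin: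
  assumes "h \<in> histories K"
  shows "history_prob K (\<lambda>_. 0) h = (if h = null_history K then 1 else 0)"
proof (cases "h = null_history K")
  case True
  then show ?thesis by (simp add: history_prob_def null_history_def)
next
  case False
  then obtain k where "k \<in> {1..K}" "h k \<noteq> 0"
    using PiE_ext[OF assms[unfolded histories_def], of "null_history K"]
      null_history_in_histories[of K]
    by (force simp: histories_def null_history_def)
  with False show ?thesis
    by (force simp: history_prob_def)
qed

lemma not_identifiable_latent_class_models:
  assumes "K \<ge> 1" "K < 2 * J"
  shows "\<not> identifiable K (latent_class_models J K)"
proof
  assume ident: "identifiable K (latent_class_models J K)"
  define n where "n = 2 * J"
  define b where "b i = real (n choose i)" for i
  have "J \<ge> 1" using assms by simp
  have b_pos: "b i > 0" if "i \<le> n" for i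
    using that by (simp add: b_def zero_less_binomial)
  define E where "E = (\<Sum>j = 1..J. b (2 * j))"
  define D where "D = (\<Sum>j = 1..J. b (2 * j - 1))"
  \<comment> \<open>Up to the factors \<open>E\<close> and \<open>D\<close>, the even and odd atoms carry binomial coefficients; the lone
    coefficient at \<open>i = 0\<close> makes the odd side heavier by \<open>1\<close>.\<close>
  have balance: "E = D - 1"
  proof -
    have "(\<Sum>i\<le>2 * J. (-1) ^ i * b i) = 0"
      using alternating_binomial_sum_poly_eq_0[of 1 n] \<open>J \<ge> 1\<close> by (simp add: b_def n_def)
    then show ?thesis
      unfolding sum_even_odd_split by (simp add: E_def D_def b_def)
  qed
  have "E > 0"
    unfolding E_def using \<open>J \<ge> 1\<close> b_pos by (intro sum_pos) (auto simp: n_def)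
  then have "D > 0" using balance by simp

  define \<nu> where "\<nu> j = b (2 * j) / E" for j
  define lam where "lam = (\<lambda>j k::nat. real (2 * j) / real n)"
  define \<mu> where "\<mu> j = b (2 * j - 1) / D" for j
  define eta where "eta = (\<lambda>j k::nat. real (2 * j - 1) / real n)"
  have \<nu>: "\<And>j. j \<in> {1..J} \<Longrightarrow> 0 \<le> \<nu> j" "(\<Sum>j = 1..J. \<nu> j) = 1"
    using \<open>E > 0\<close> by (auto simp: \<nu>_def b_def sum_divide_distrib [symmetric] E_def)
  have \<mu>: "\<And>j. j \<in> {1..J} \<Longrightarrow> 0 \<le> \<mu> j" "(\<Sum>j = 1..J. \<mu> j) = 1"
    using \<open>D > 0\<close> by (auto simp: \<mu>_def b_def sum_divide_distrib [symmetric] D_def)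
  have lam: "lam j k \<in> {0<..1}" if "j \<in> {1..J}" for j k
    using that by (auto simp: lam_def n_def divide_simps)
  have eta: "eta j k \<in> {0<..1}" if "j \<in> {1..J}" for j k
    using that by (auto simp: eta_def n_def divide_simps)
  define Q where "Q = latent_class_model J K \<nu> lam"
  define R where "R = latent_class_model J K \<mu> eta"
  have "Q \<in> latent_class_models J K"
    unfolding latent_class_models_def Q_def latent_class_model_def using \<nu> lam
    by (intro CollectI exI[of _ \<nu>] exI[of _ lam]) (auto simp: lam_def n_def)
  moreover have "R \<in> latent_class_models J K"
    unfolding latent_class_models_def R_def latent_class_model_def using \<mu> eta
    by (intro CollectI exI[of _ \<mu>] exI[of _ eta]) (auto simp: eta_def n_def divide_simps)
  moreover
  have cell_balance:
    "E * cell_prob K Q h = D * cell_prob K R h - (if h = null_history K then 1 else 0)"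
    if h: "h \<in> histories K" for h
  proof -
    obtain p where p: "degree p \<le> K" "\<And>y. poly p y = history_prob K (\<lambda>_. y / real n) h"
      using history_prob_diagonal_poly[OF h] by metis
    have Q_cell': "cell_prob K Q h = (\<Sum>j = 1..J. \<nu> j * history_prob K (lam j) h)"
      unfolding Q_def using \<nu> lam by (intro cell_prob_latent_class_model)
    have Q_cell: "E * cell_prob K Q h = (\<Sum>j = 1..J. b (2 * j) * poly p (real (2 * j)))"
      unfolding Q_cell' using \<open>E > 0\<close> by (simp add: \<nu>_def lam_def p sum_distrib_left)
    have R_cell': "cell_prob K R h = (\<Sum>j = 1..J. \<mu> j * history_prob K (eta j) h)"
      unfolding R_def using \<mu> eta by (intro cell_prob_latent_class_model)
    have R_cell: "D * cell_prob K R h = (\<Sum>j = 1..J. b (2 * j - 1) * poly p (real (2 * j - 1)))"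
      unfolding R_cell' using \<open>D > 0\<close> by (simp add: \<mu>_def eta_def p sum_distrib_left)
    have "(\<Sum>i\<le>2 * J. (-1) ^ i * (b i * poly p (real i))) = 0"
      using alternating_binomial_sum_poly_eq_0[of p n] p(1) assms by (simp add: b_def n_def mult_ac)
    then have "poly p 0 + E * cell_prob K Q h - D * cell_prob K R h = 0"
      unfolding sum_even_odd_split Q_cell R_cell by (simp add: b_def)
    then show ?thesis
      using history_prob_origin[OF h] by (simp add: p)
  qed
  have null_balance: "E * (1 - null_prob K Q) = D * (1 - null_prob K R)"
    unfolding null_prob_def right_diff_distrib
    using cell_balance[OF null_history_in_histories] balance by simp
  have "null_prob K Q < 1"
    unfolding Q_def using assms \<nu> lam by (intro null_prob_latent_class_model_less_1)
  have "null_prob K R < 1"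
    unfolding R_def using assms \<mu> eta by (intro null_prob_latent_class_model_less_1)
  have "observed_probs K Q = observed_probs K R"
    unfolding observed_probs_def
  proof (rule restrict_ext)
    fix h assume h: "h \<in> histories K - {null_history K}"
    have "cell_prob K Q h / (1 - null_prob K Q) = (E * cell_prob K Q h) / (E * (1 - null_prob K Q))"
      using \<open>E > 0\<close> by simp
    also have "\<dots> = (D * cell_prob K R h) / (D * (1 - null_prob K R))"
      using cell_balance[of h] h null_balance by simp
    also have "\<dots> = cell_prob K R h / (1 - null_prob K R)"
      using \<open>D > 0\<close> by simp
    finally show "cell_prob K Q h / (1 - null_prob K Q) = cell_prob K R h / (1 - null_prob K R)" .
  qed
  ultimately have "null_prob K Q = null_prob K R"
    using ident unfolding identifiable_def by blast
  with null_balance \<open>null_prob K R < 1\<close> have "E = D" by simp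
  with balance show False by simp
qed

theorem theorem2:
  fixes K J :: nat
  assumes "K \<ge> 2" and "J \<ge> 1"
  shows "identifiable K (latent_class_models J K) \<longleftrightarrow> 2 * J \<le> K"
  using identifiable_latent_class_models[of K J] not_identifiable_latent_class_models[of K J] assms
  by linarith

end
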